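(* Suppose Assumption (U) of the context holds with $P\succ 0$ as there, and let $\Xi\succ0$ be an $n_d\times n_d$ matrix. Then there exist $\Gamma\in\mathbb R^{n_y\times n_y}$, $\Gamma\succ0$, and $\gamma>0$ satisfying $$N^\top\begin{bmatrix}-\rho^2P&0&0&0 \\ 0&P&0&0 \\ 0&0&M&0 \\ 0&0&0&-\Lambda\end{bmatrix}N\prec0,\qquad N=\begin{bmatrix}I&0&0 \\ \mathcal A&\mathcal B&\begin{bmatrix}B_G^d&0 \\ B_\Psi^yD_G^d&B_\Psi^y\end{bmatrix} \\ \mathcal C&\mathcal D&\begin{bmatrix}D_\Psi^yD_G^d&D_\Psi^y\end{bmatrix} \\ 0&0&I\end{bmatrix},\qquad \Lambda=\mathrm{diag}(\gamma\,\Xi,\Gamma).$$ Further, for any such $\Gamma,\gamma$ and any sequences $d\in\ell_{2e}^{n_d}$, $(r_{\cdot|t})_{t\in\mathbb N}$ with $r_{\cdot|t}\in\ell_{2e}^{n_y}$, and $e_{0|\cdot}\in\ell_{2e}^{n_x}$, the resulting signals $e_{k|t}$, $\psi_{k|t}$ of the interconnection described in the context satisfy, for all $t\ge0$ and all $k\ge0$, $$\left\|\begin{bmatrix}e_{k|t} \\ \psi_{k|t}\end{bmatrix}\right\|_P^2\le c_{k|t},$$ where $c_{0|0}=\left\|\begin{bmatrix}e_{0|0} \\ 0\end{bmatrix}\right\|_P^2$ and $c_{k|t}$ is recursively defined by $$c_{k+1|t}=\rho^2c_{k|t}+\gamma\|d_{t+k}\|_\Xi^2+\|r_{k|t}\|_\Gamma^2,$$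 $$c_{0|t+1}=c_{1|t}+\left\|\begin{bmatrix}e_{0|t+1} \\ \psi_{0|t+1}\end{bmatrix}\right\|_P^2-\left\|\begin{bmatrix}e_{1|t} \\ \psi_{1|t}\end{bmatrix}\right\|_P^2 .$$
   Context: **Notation.** $\ell_{2e}^n$ is the set of all sequences $(q_k)_{k\in\mathbb N}$ in $\mathbb R^n$. For $X\succ0$, $\|x\|_X^2=x^\top Xx$. **Interconnection.** Real matrices $A_G,B_G^w,B_G^d,C_G,D_G^w,D_G^d$ of compatible sizes and a bounded causal operator $\Delta:\ell_{2e}^{n_y}\to\ell_{2e}^{n_w}$ are given, and their feedback interconnection is well-posed (unique responses exist). The index $k|t$ denotes a prediction $k$ steps ahead made at time $t$. For $t,k\ge0$ the signals satisfy $$e_{k+1|t}=A_Ge_{k|t}+B_G^ww_{k|t}+B_G^dd_{k+t},\qquad y_{k|t}=C_Ge_{k|t}+D_G^ww_{k|t}+D_G^dd_{k+t}+r_{k|t},\qquad w_{k|t}=\Delta(y^{(t)})_{t+k},$$ where $y^{(t)}\in\ell_{2e}^{n_y}$ is the sequence consisting of the realized past followed by the prediction: $y^{(t)}_j=y_{0|j}$ for $0\le j<t$ and $y^{(t)}_{t+k}=y_{k|t}$ for $k\ge0$. The initial values $e_{0|t}$, $t\ge0$, are arbitrary (in particular $e_{0|t+1}$ need not equal $e_{1|t}$). **Filter.** $\Psi$ is a stable discrete-time LTI filter (real rational proper transfer matrix with all poles in the open unit disk) with state-space matrices $(A_\Psi,[B_\Psi^y\ B_\Psi^w],C_\Psi,[D_\Psi^y\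 D_\Psi^w])$, inputs $y$ and $w$, state $\psi$, output $p\in\mathbb R^{n_p}$. Along predictions, $$\psi_{k+1|t}=A_\Psi\psi_{k|t}+B_\Psi^yy_{k|t}+B_\Psi^ww_{k|t},\qquad p_{k|t}=C_\Psi\psi_{k|t}+D_\Psi^yy_{k|t}+D_\Psi^ww_{k|t},$$ with $\psi_{0|t+1}=\psi_{1|t}$ and $\psi_{0|0}=\psi_0=0$. **$\rho$-hard IQC.** For $M=M^\top\in\mathbb R^{n_p\times n_p}$, $\Delta$ satisfies the $\rho$-hard IQC defined by $(\Psi,M)$ if for all $y\in\ell_{2e}^{n_y}$ and all $T\ge1$: $\sum_{t=0}^{T-1}\rho^{-2t}p_t^\top Mp_t\ge0$, where $p=\Psi\begin{bmatrix}y \\ \Delta(y)\end{bmatrix}$ (zero initial filter state). **Augmented matrices.** $$\mathcal A=\begin{bmatrix}A_G&0 \\ B_\Psi^yC_G&A_\Psi\end{bmatrix},\ \mathcal B=\begin{bmatrix}B_G^w \\ B_\Psi^yD_G^w+B_\Psi^w\end{bmatrix},\ \mathcal C=\begin{bmatrix}D_\Psi^yC_G&C_\Psi\end{bmatrix},\ \mathcal D=D_\Psi^yD_G^w+D_\Psi^w.$$ **Assumption (U).** $\rho\in(0,1]$; $\Delta$ satisfies the $\rho$-hard IQC defined by $(\Psi,M)$; $\psi_0=0$; and there exists $P\succ0$ with $$\begin{bmatrix}I&0 \\ \mathcal A&\mathcal B \\ \mathcal C&\mathcal D\end{bmatrix}^\top\begin{bmatrix}-\rho^2P&0&0 \\ 0&P&0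 \\ 0&0&M\end{bmatrix}\begin{bmatrix}I&0 \\ \mathcal A&\mathcal B \\ \mathcal C&\mathcal D\end{bmatrix}\prec0 .$$ *)

theory Defs
  imports "HOL-Analysis.Analysis" "HOL-Complex_Analysis.Complex_Analysis"
begin

section \<open>Block vectors and block matrices\<close>

text \<open>A vector of vectors is a matrix with the inner vectors as rows. Hence \<open>vcat\<close> stacks
  vectors (with real entries) as well as matrices (with entries that are rows).\<close>

definition vcat :: "'a ^ 'm \<Rightarrow> 'a ^ 'n \<Rightarrow> 'a ^ ('m + 'n)" where
  "vcat x z = (\<chi> i. case i of Inl a \<Rightarrow> x $ a | Inr b \<Rightarrow> z $ b)"

definition hcat :: "'a ^ 'm ^ 'k \<Rightarrow> 'a ^ 'n ^ 'k \<Rightarrow> 'a ^ ('m + 'n) ^ 'k" where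
  "hcat X Y = (\<chi> i. vcat (X $ i) (Y $ i))"

definition block2 ::
  "'a ^ 'm ^ 'k \<Rightarrow> 'a ^ 'n ^ 'k \<Rightarrow> 'a ^ 'm ^ 'l \<Rightarrow> 'a ^ 'n ^ 'l \<Rightarrow> 'a ^ ('m + 'n) ^ ('k + 'l)" where
  "block2 X Y Z W = vcat (hcat X Y) (hcat Z W)"

definition block_diag :: "real ^ 'm ^ 'k \<Rightarrow> real ^ 'n ^ 'l \<Rightarrow> real ^ ('m + 'n) ^ ('k + 'l)" where
  "block_diag X Y = block2 X 0 0 Y"

definition pos_def :: "real ^ 'n ^ 'n \<Rightarrow> bool" where
  "pos_def X \<longleftrightarrow> transpose X = X \<and> (\<forall>v. v \<noteq> 0 \<longrightarrow> v \<bullet> (X *v v) > 0)"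

definition neg_def :: "real ^ 'n ^ 'n \<Rightarrow> bool" where
  "neg_def X \<longleftrightarrow> transpose X = X \<and> (\<forall>v. v \<noteq> 0 \<longrightarrow> v \<bullet> (X *v v) < 0)"

definition wnorm_sq :: "real ^ 'n ^ 'n \<Rightarrow> real ^ 'n \<Rightarrow> real" where
  "wnorm_sq X x = x \<bullet> (X *v x)"


section \<open>Plant, operator and their interconnection\<close>

type_synonym 'n signal = "nat \<Rightarrow> real ^ 'n"

text \<open>A prediction signal \<open>s :: 'n predictions\<close> is read as $s_{k|t} =$ \<open>s t k\<close>: the first
  argument is the time at which the prediction is made, the second the number of steps ahead.\<close>

type_synonym 'n predictions = "nat \<Rightarrow> nat \<Rightarrow> real ^ 'n"

record ('x::finite, 'w::finite, 'd::finite, 'y::finite) plant =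
  A_G :: "real ^ 'x ^ 'x"
  Bw_G :: "real ^ 'w ^ 'x"
  Bd_G :: "real ^ 'd ^ 'x"
  C_G :: "real ^ 'x ^ 'y"
  Dw_G :: "real ^ 'w ^ 'y"
  Dd_G :: "real ^ 'd ^ 'y"

definition causal :: "('y::finite signal \<Rightarrow> 'w::finite signal) \<Rightarrow> bool" where
  "causal \<Delta> \<longleftrightarrow> (\<forall>y y' T. (\<forall>j\<le>T. y j = y' j) \<longrightarrow> (\<forall>j\<le>T. \<Delta> y j = \<Delta> y' j))"

text \<open>Finite \<open>\<ell>\<^sub>2\<close>-gain, in the form for extended spaces, that is, on all truncations.\<close>

definition bounded_operator :: "('y::finite signal \<Rightarrow> 'w::finite signal) \<Rightarrow> bool" where
  "bounded_operator \<Delta> \<longleftrightarrow>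
     (\<exists>c\<ge>0. \<forall>y T. sqrt (\<Sum>j<T. (norm (\<Delta> y j))\<^sup>2) \<le> c * sqrt (\<Sum>j<T. (norm (y j))\<^sup>2))"

text \<open>The realized past $y_{0|0}, \dots, y_{0|t-1}$ followed by the prediction made at time \<open>t\<close>.\<close>

definition realized_then_predicted :: "'y::finite predictions \<Rightarrow> nat \<Rightarrow> 'y signal" where
  "realized_then_predicted y t j = (if j < t then y j 0 else y t (j - t))"

definition interconnection ::
  "('x::finite, 'w::finite, 'd::finite, 'y::finite) plant \<Rightarrow> ('y signal \<Rightarrow> 'w signal) \<Rightarrow>
   'd signal \<Rightarrow> 'y predictions \<Rightarrow> 'x signal \<Rightarrow>
   'x predictions \<Rightarrow> 'w predictions \<Rightarrow> 'y predictions \<Rightarrow> bool" where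
  "interconnection G \<Delta> d r e0 e w y \<longleftrightarrow>
     (\<forall>t. e t 0 = e0 t) \<and>
     (\<forall>t k. e t (Suc k) = A_G G *v e t k + Bw_G G *v w t k + Bd_G G *v d (k + t)) \<and>
     (\<forall>t k. y t k = C_G G *v e t k + Dw_G G *v w t k + Dd_G G *v d (k + t) + r t k) \<and>
     (\<forall>t k. w t k = \<Delta> (realized_then_predicted y t) (t + k))"

definition well_posed ::
  "('x::finite, 'w::finite, 'd::finite, 'y::finite) plant \<Rightarrow> ('y signal \<Rightarrow> 'w signal) \<Rightarrow> bool" where
  "well_posed G \<Delta> \<longleftrightarrow>
     (\<forall>d r e0. \<exists>!s. case s of (e, w, y) \<Rightarrow> interconnection G \<Delta> d r e0 e w y)"


section \<open>Filter and integral quadratic constraint\<close>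

record ('s::finite, 'y::finite, 'w::finite, 'p::finite) filter_ss =
  A_F :: "real ^ 's ^ 's"
  By_F :: "real ^ 'y ^ 's"
  Bw_F :: "real ^ 'w ^ 's"
  C_F :: "real ^ 's ^ 'p"
  Dy_F :: "real ^ 'y ^ 'p"
  Dw_F :: "real ^ 'w ^ 'p"

definition transfer_matrix ::
  "('s::finite, 'y::finite, 'w::finite, 'p::finite) filter_ss \<Rightarrow> complex \<Rightarrow> complex ^ ('y + 'w) ^ 'p" where
  "transfer_matrix F z =
     map_matrix of_real (C_F F) ** matrix_inv (mat z - map_matrix of_real (A_F F))
       ** map_matrix of_real (hcat (By_F F) (Bw_F F))
     + map_matrix of_real (hcat (Dy_F F) (Dw_F F))"

text \<open>The junk value of \<open>matrix_inv\<close> at the finitely many eigenvalues of \<open>A_F F\<close> is harmless: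
  \<open>is_pole f z\<close> depends only on the values of \<open>f\<close> in punctured neighbourhoods of \<open>z\<close>.
  The condition is on the poles of the transfer matrix, the realization need not be minimal.\<close>

definition stable_filter :: "('s::finite, 'y::finite, 'w::finite, 'p::finite) filter_ss \<Rightarrow> bool" where
  "stable_filter F \<longleftrightarrow> (\<forall>i j z. is_pole (\<lambda>z. transfer_matrix F z $ i $ j) z \<longrightarrow> norm z < 1)"

primrec filter_state ::
  "('s::finite, 'y::finite, 'w::finite, 'p::finite) filter_ss \<Rightarrow> 'y signal \<Rightarrow> 'w signal \<Rightarrow> 's signal" where
  "filter_state F y w 0 = 0"
| "filter_state F y w (Suc t) = A_F F *v filter_state F y w t + By_F F *v y t + Bw_F F *v w t"

definition filter_output ::
  "('s::finite, 'y::finite, 'w::finite, 'p::finite) filter_ss \<Rightarrow> 'y signal \<Rightarrow> 'w signal \<Rightarrow> 'p signal" where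
  "filter_output F y w t = C_F F *v filter_state F y w t + Dy_F F *v y t + Dw_F F *v w t"

definition rho_hard_IQC ::
  "real \<Rightarrow> ('s::finite, 'y::finite, 'w::finite, 'p::finite) filter_ss \<Rightarrow> real ^ 'p ^ 'p \<Rightarrow>
   ('y signal \<Rightarrow> 'w signal) \<Rightarrow> bool" where
  "rho_hard_IQC \<rho> F M \<Delta> \<longleftrightarrow>
     (\<forall>y. \<forall>T\<ge>1. (\<Sum>t<T. \<rho> powi (- 2 * int t) *
        (filter_output F y (\<Delta> y) t \<bullet> (M *v filter_output F y (\<Delta> y) t))) \<ge> 0)"

definition filter_predictions ::
  "('s::finite, 'y::finite, 'w::finite, 'p::finite) filter_ss \<Rightarrow>
   'y predictions \<Rightarrow> 'w predictions \<Rightarrow> 's predictions \<Rightarrow> 'p predictions \<Rightarrow> bool" where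
  "filter_predictions F y w \<psi> p \<longleftrightarrow>
     \<psi> 0 0 = 0 \<and>
     (\<forall>t. \<psi> (Suc t) 0 = \<psi> t 1) \<and>
     (\<forall>t k. \<psi> t (Suc k) = A_F F *v \<psi> t k + By_F F *v y t k + Bw_F F *v w t k) \<and>
     (\<forall>t k. p t k = C_F F *v \<psi> t k + Dy_F F *v y t k + Dw_F F *v w t k)"


section \<open>Augmented matrices and matrix inequalities\<close>

definition aug_A ::
  "('x::finite, 'w::finite, 'd::finite, 'y::finite) plant \<Rightarrow> ('s::finite, 'y, 'w, 'p::finite) filter_ss \<Rightarrow>
   real ^ ('x + 's) ^ ('x + 's)" where
  "aug_A G F = block2 (A_G G) 0 (By_F F ** C_G G) (A_F F)"

definition aug_B ::
  "('x::finite, 'w::finite, 'd::finite, 'y::finite) plant \<Rightarrow> ('s::finite, 'y, 'w, 'p::finite) filter_ss \<Rightarrow>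
   real ^ 'w ^ ('x + 's)" where
  "aug_B G F = vcat (Bw_G G) (By_F F ** Dw_G G + Bw_F F)"

definition aug_C ::
  "('x::finite, 'w::finite, 'd::finite, 'y::finite) plant \<Rightarrow> ('s::finite, 'y, 'w, 'p::finite) filter_ss \<Rightarrow>
   real ^ ('x + 's) ^ 'p" where
  "aug_C G F = hcat (Dy_F F ** C_G G) (C_F F)"

definition aug_D ::
  "('x::finite, 'w::finite, 'd::finite, 'y::finite) plant \<Rightarrow> ('s::finite, 'y, 'w, 'p::finite) filter_ss \<Rightarrow>
   real ^ 'w ^ 'p" where
  "aug_D G F = Dy_F F ** Dw_G G + Dw_F F"

definition aug_Bd ::
  "('x::finite, 'w::finite, 'd::finite, 'y::finite) plant \<Rightarrow> ('s::finite, 'y, 'w, 'p::finite) filter_ss \<Rightarrow>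
   real ^ ('d + 'y) ^ ('x + 's)" where
  "aug_Bd G F = block2 (Bd_G G) 0 (By_F F ** Dd_G G) (By_F F)"

definition aug_Dd ::
  "('x::finite, 'w::finite, 'd::finite, 'y::finite) plant \<Rightarrow> ('s::finite, 'y, 'w, 'p::finite) filter_ss \<Rightarrow>
   real ^ ('d + 'y) ^ 'p" where
  "aug_Dd G F = hcat (Dy_F F ** Dd_G G) (Dy_F F)"

definition nominal_LMI ::
  "('x::finite, 'w::finite, 'd::finite, 'y::finite) plant \<Rightarrow> ('s::finite, 'y, 'w, 'p::finite) filter_ss \<Rightarrow>
   real ^ 'p ^ 'p \<Rightarrow> real \<Rightarrow> real ^ ('x + 's) ^ ('x + 's) \<Rightarrow> bool" where
  "nominal_LMI G F M \<rho> P \<longleftrightarrow>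
     (let L = vcat (hcat (mat 1) 0)
             (vcat (hcat (aug_A G F) (aug_B G F))
                   (hcat (aug_C G F) (aug_D G F)))
      in neg_def (transpose L ** block_diag (- (\<rho>\<^sup>2 *\<^sub>R P)) (block_diag P M) ** L))"

definition disturbance_LMI ::
  "('x::finite, 'w::finite, 'd::finite, 'y::finite) plant \<Rightarrow> ('s::finite, 'y, 'w, 'p::finite) filter_ss \<Rightarrow>
   real ^ 'p ^ 'p \<Rightarrow> real \<Rightarrow> real ^ ('x + 's) ^ ('x + 's) \<Rightarrow>
   real ^ 'd ^ 'd \<Rightarrow> real ^ 'y ^ 'y \<Rightarrow> real \<Rightarrow> bool" where
  "disturbance_LMI G F M \<rho> P \<Xi> \<Gamma> \<gamma> \<longleftrightarrow>
     (let \<Lambda> = block_diag (\<gamma> *\<^sub>R \<Xi>) \<Gamma>;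
          N = vcat (hcat (mat 1) (hcat 0 0))
             (vcat (hcat (aug_A G F) (hcat (aug_B G F) (aug_Bd G F)))
             (vcat (hcat (aug_C G F) (hcat (aug_D G F) (aug_Dd G F)))
                   (hcat 0 (hcat 0 (mat 1)))))
      in neg_def (transpose N **
           block_diag (- (\<rho>\<^sup>2 *\<^sub>R P)) (block_diag P (block_diag M (- \<Lambda>))) ** N))"


section \<open>The bounding sequence\<close>

text \<open>As for predictions, $c_{k|t}$ is \<open>bound_c \<dots> t k\<close>.\<close>

fun bound_c ::
  "real ^ ('x::finite + 's::finite) ^ ('x + 's) \<Rightarrow> real \<Rightarrow>
   real ^ 'd::finite ^ 'd \<Rightarrow> real ^ 'y::finite ^ 'y \<Rightarrow> real \<Rightarrow>
   'd signal \<Rightarrow> 'y predictions \<Rightarrow> 'x predictions \<Rightarrow> 's predictions \<Rightarrow> nat \<Rightarrow> nat \<Rightarrow> real" where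
  "bound_c P \<rho> \<Xi> \<Gamma> \<gamma> d r e \<psi> 0 0 = wnorm_sq P (vcat (e 0 0) 0)"
| "bound_c P \<rho> \<Xi> \<Gamma> \<gamma> d r e \<psi> (Suc t) 0 =
     bound_c P \<rho> \<Xi> \<Gamma> \<gamma> d r e \<psi> t 1
     + wnorm_sq P (vcat (e (Suc t) 0) (\<psi> (Suc t) 0))
     - wnorm_sq P (vcat (e t 1) (\<psi> t 1))"
| "bound_c P \<rho> \<Xi> \<Gamma> \<gamma> d r e \<psi> t (Suc k) =
     \<rho>\<^sup>2 * bound_c P \<rho> \<Xi> \<Gamma> \<gamma> d r e \<psi> t k + \<gamma> * wnorm_sq \<Xi> (d (t + k)) + wnorm_sq \<Gamma> (r t k)"

end

theory Submission
  imports Defs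
begin

unbundle no fps_syntax

text \<open>Existence: the nominal inequality bounds the quadratic form by $-\varepsilon\|a\|^2$ on the state and
  operator part \<open>a\<close>, so by Young's inequality the cross terms with the disturbance part are dominated
  once \<open>\<gamma>\<close> is large; \<open>\<Gamma>\<close> can be taken to be a multiple of the identity.

  Bound: the inequality with disturbances is the dissipation inequality
  $c_{k+1|t} - V_{k+1|t} \ge \rho^2 (c_{k|t} - V_{k|t}) + p_{k|t}^\top M p_{k|t}$ for the storage function
  $V = \|\cdot\|_P^2$, and the correction in $c_{0|t+1}$ makes $c - V$ continuous at the change of
  prediction. By causality the realized values followed by the prediction form a single
  input-output pair of \<open>\<Delta>\<close>. Hence $\rho^{-2(t+k)}(c_{k|t} - V_{k|t})$ is at least $\rho^{-2}$ times a
  partial sum of the IQC of that pair.\<close>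

section \<open>Block vectors and quadratic forms\<close>

lemma vcat_nth [simp]: "vcat a b $ Inl i = a $ i" "vcat a b $ Inr j = b $ j"
  by (simp_all add: vcat_def)

lemma sum_UNIV_Plus:
  fixes f :: "'m::finite + 'n::finite \<Rightarrow> 'b::comm_monoid_add"
  shows "sum f UNIV = (\<Sum>i\<in>UNIV. f (Inl i)) + (\<Sum>j\<in>UNIV. f (Inr j))"
  by (simp add: UNIV_Plus_UNIV [symmetric] sum.Plus del: UNIV_Plus_UNIV)

lemma vec_Plus_eq_iff:
  "a = b \<longleftrightarrow> (\<forall>i. a $ Inl i = b $ Inl i) \<and> (\<forall>j. a $ Inr j = b $ Inr j)"
  by (simp add: vec_eq_iff split_sum_all)

lemma vcat_zero [simp]: "vcat 0 0 = 0"
  by (simp add: vec_Plus_eq_iff)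

lemma vcat_eq_0_iff [simp]: "vcat a b = 0 \<longleftrightarrow> a = 0 \<and> b = 0"
  by (simp add: vec_Plus_eq_iff vec_eq_iff)

lemma vcat_add: "vcat a b + vcat c d = vcat (a + c) (b + d)"
  by (simp add: vec_Plus_eq_iff)

lemma vcat_surj:
  obtains a b where "z = vcat a b"
proof
  show "z = vcat (\<chi> i. z $ Inl i) (\<chi> j. z $ Inr j)"
    by (simp add: vec_Plus_eq_iff)
qed

lemma inner_vcat:
  fixes a c :: "real ^ 'm::finite" and b d :: "real ^ 'n::finite"
  shows "vcat a b \<bullet> vcat c d = a \<bullet> c + b \<bullet> d"
  by (simp add: inner_vec_def sum_UNIV_Plus)

lemma vcat_mult_vec:
  fixes A :: "real ^ 'k::finite ^ 'm::finite" and B :: "real ^ 'k ^ 'n::finite"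
  shows "vcat A B *v x = vcat (A *v x) (B *v x)"
  by (simp add: vec_Plus_eq_iff matrix_vector_mult_def)

lemma hcat_mult_vcat:
  fixes A :: "real ^ 'm::finite ^ 'k::finite" and B :: "real ^ 'n::finite ^ 'k"
  shows "hcat A B *v vcat x z = A *v x + B *v z"
  by (simp add: vec_eq_iff matrix_vector_mult_def hcat_def sum_UNIV_Plus)

lemma block2_mult_vcat:
  fixes A :: "real ^ 'm::finite ^ 'k::finite" and D :: "real ^ 'n::finite ^ 'l::finite"
  shows "block2 A B C D *v vcat x z = vcat (A *v x + B *v z) (C *v x + D *v z)"
  by (simp add: block2_def vcat_mult_vec hcat_mult_vcat)

lemma transpose_block_diag: "transpose (block_diag X Y) = block_diag (transpose X) (transpose Y)"
  by (simp add: vec_Plus_eq_iff transpose_def block_diag_def block2_def hcat_def)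

lemma transpose_minus: "transpose (- X :: real ^ 'n ^ 'm) = - transpose X"
  by (simp add: vec_eq_iff transpose_def)

lemma transpose_scaleR: "transpose (c *\<^sub>R X) = c *\<^sub>R transpose X" for X :: "real ^ 'n ^ 'm"
  by (simp add: vec_eq_iff transpose_def)

section \<open>Weighted squared norms as quadratic forms\<close>

lemma wnorm_sq_zero [simp]: "wnorm_sq X 0 = 0"
  by (simp add: wnorm_sq_def)

lemma wnorm_sq_minus [simp]: "wnorm_sq (- X) v = - wnorm_sq X v"
  by (simp add: wnorm_sq_def inner_vec_def matrix_vector_mult_def sum_negf)

lemma wnorm_sq_scaleR_matrix [simp]: "wnorm_sq (c *\<^sub>R X) v = c * wnorm_sq X v"
  by (simp add: wnorm_sq_def scaleR_matrix_vector_assoc [symmetric])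

lemma wnorm_sq_mat_1 [simp]: "wnorm_sq (mat 1) v = (norm v)\<^sup>2"
  by (simp add: wnorm_sq_def power2_norm_eq_inner)

lemma wnorm_sq_block_diag:
  "wnorm_sq (block_diag X Y) (vcat a b) = wnorm_sq X a + wnorm_sq Y b"
  by (simp add: wnorm_sq_def block_diag_def block2_mult_vcat inner_vcat)

lemma wnorm_sq_scaleR: "wnorm_sq X (c *\<^sub>R v) = c\<^sup>2 * wnorm_sq X v"
  by (simp add: wnorm_sq_def matrix_vector_mult_scaleR power2_eq_square)

lemma wnorm_sq_add:
  assumes "transpose X = X"
  shows "wnorm_sq X (a + b) = wnorm_sq X a + 2 * (a \<bullet> (X *v b)) + wnorm_sq X b"
proof -
  have "b \<bullet> (X *v a) = a \<bullet> (X *v b)"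
    by (metis assms dot_lmul_matrix inner_commute transpose_matrix_vector)
  then show ?thesis
    by (simp add: wnorm_sq_def matrix_vector_right_distrib inner_add)
qed

lemma wnorm_sq_congruence: "wnorm_sq (transpose L ** X ** L) v = wnorm_sq X (L *v v)"
proof -
  have "wnorm_sq (transpose L ** X ** L) v = v \<bullet> (transpose L *v (X *v (L *v v)))"
    by (simp add: wnorm_sq_def matrix_vector_mul_assoc [symmetric])
  also have "\<dots> = wnorm_sq X (L *v v)"
    by (metis dot_lmul_matrix vector_transpose_matrix transpose_transpose transpose_matrix_vector wnorm_sq_def)
  finally show ?thesis .
qed

text \<open>Congruence preserves symmetry, so only the sign condition remains. It becomes a scalar
  inequality on the vectors \<open>L *v v\<close>, which is how both matrix inequalities are
  used.\<close>

lemma neg_def_congruence: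
  assumes "transpose X = X"
  shows "neg_def (transpose L ** X ** L) \<longleftrightarrow> (\<forall>v. v \<noteq> 0 \<longrightarrow> wnorm_sq X (L *v v) < 0)"
proof -
  have "transpose (transpose L ** X ** L) = transpose L ** X ** L"
    by (simp add: matrix_transpose_mul assms matrix_mul_assoc)
  then show ?thesis
    by (simp add: neg_def_def flip: wnorm_sq_def wnorm_sq_congruence)
qed

section \<open>Coercivity and perturbation of definite forms\<close>

text \<open>The form attains a minimum on the compact unit sphere, which is positive; homogeneity of
  degree two extends the bound to all vectors.\<close>

lemma definite_coercive:
  assumes "\<And>v. v \<noteq> 0 \<Longrightarrow> 0 < wnorm_sq X v"
  obtains \<epsilon> where "\<epsilon> > 0" "\<And>v. \<epsilon> * (norm v)\<^sup>2 \<le> wnorm_sq X v"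
proof -
  have "continuous_on (sphere 0 1) (wnorm_sq X)"
    unfolding wnorm_sq_def [abs_def]
    by (intro continuous_on_inner continuous_on_id linear_continuous_on matrix_vector_mul_bounded_linear)
  \<comment> \<open>Index types are inhabited, so the space has positive dimension.\<close>
  moreover have "sphere (0 :: real ^ 'a) 1 \<noteq> {}"
    by simp
  ultimately obtain u where u: "u \<in> sphere 0 1" "\<And>v. v \<in> sphere 0 1 \<Longrightarrow> wnorm_sq X u \<le> wnorm_sq X v"
    using continuous_attains_inf [OF compact_sphere] by blast
  have "wnorm_sq X u * (norm v)\<^sup>2 \<le> wnorm_sq X v" for v
  proof (cases "v = 0")
    case False
    then have "wnorm_sq X v = (norm v)\<^sup>2 * wnorm_sq X (sgn v)"
      by (simp add: sgn_div_norm wnorm_sq_scaleR power_inverse)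
    moreover have "wnorm_sq X u \<le> wnorm_sq X (sgn v)"
      using False by (intro u) (simp add: norm_sgn)
    ultimately show ?thesis
      by (simp add: mult.commute mult_right_mono)
  qed simp
  moreover have "wnorm_sq X u > 0"
    using u by (intro assms) auto
  ultimately show thesis
    using that by blast
qed

text \<open>The form is uniformly negative along \<open>K\<close>. Half of this margin absorbs the
  cross term with \<open>H *v v\<close>; everything else is of order \<open>(norm v)\<^sup>2\<close>
  and is paid for by \<open>c\<close>.\<close>

lemma neg_def_perturbation:
  fixes X :: "real ^ 'k::finite ^ 'k" and K :: "real ^ 'm::finite ^ 'k" and H :: "real ^ 'n::finite ^ 'k"
  assumes sym: "transpose X = X" and neg: "\<And>a. a \<noteq> 0 \<Longrightarrow> wnorm_sq X (K *v a) < 0"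
  obtains c where "c > 0"
    "\<And>a v. a \<noteq> 0 \<or> v \<noteq> 0 \<Longrightarrow> wnorm_sq X (K *v a + H *v v) < c * (norm v)\<^sup>2"
proof -
  obtain \<epsilon> where \<epsilon>: "\<epsilon> > 0" "\<And>a. \<epsilon> * (norm a)\<^sup>2 \<le> - wnorm_sq X (K *v a)"
  proof (rule definite_coercive [of "- (transpose K ** X ** K)"])
    show "0 < wnorm_sq (- (transpose K ** X ** K)) v" if "v \<noteq> 0" for v
      using neg [OF that] by (simp add: wnorm_sq_congruence)
  qed (simp add: wnorm_sq_congruence)
  \<comment> \<open>Operator norms of the cross block and of the pure \<open>H\<close> block in the
    expanded form.\<close>
  define B where "B = onorm ((*v) (transpose K ** X ** H))"
  define C where "C = onorm ((*v) (transpose H ** X ** H))"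
  have nonneg: "B \<ge> 0" "C \<ge> 0"
    by (simp_all add: B_def C_def onorm_pos_le)
  have B: "(K *v a) \<bullet> (X *v (H *v v)) \<le> B * norm a * norm v" for a v
  proof -
    have "(K *v a) \<bullet> (X *v (H *v v)) = a \<bullet> ((transpose K ** X ** H) *v v)"
      by (metis dot_lmul_matrix matrix_vector_mul_assoc transpose_transpose transpose_matrix_vector)
    also have "\<dots> \<le> norm a * norm ((transpose K ** X ** H) *v v)"
      by (rule norm_cauchy_schwarz)
    also have "\<dots> \<le> norm a * (B * norm v)"
      unfolding B_def by (intro mult_left_mono onorm) simp_all
    finally show ?thesis by (simp add: mult_ac)
  qed
  have C: "wnorm_sq X (H *v v) \<le> C * (norm v)\<^sup>2" for v
  proof -
    have "wnorm_sq X (H *v v) = v \<bullet> ((transpose H ** X ** H) *v v)"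
      by (metis wnorm_sq_congruence wnorm_sq_def)
    also have "\<dots> \<le> norm v * norm ((transpose H ** X ** H) *v v)"
      by (rule norm_cauchy_schwarz)
    also have "\<dots> \<le> norm v * (C * norm v)"
      unfolding C_def by (intro mult_left_mono onorm) simp_all
    finally show ?thesis by (simp add: power2_eq_square mult_ac)
  qed
  show thesis
  proof
    \<comment> \<open>\<open>C\<close> pays for the pure term in \<open>v\<close>, the fraction for
      the Young remainder, and the final 1 leaves slack that makes the inequality strict also when
      \<open>a = 0\<close>.\<close>
    show "C + 2 * B\<^sup>2 / \<epsilon> + 1 > 0"
      using nonneg \<epsilon>(1) by (intro add_nonneg_pos) auto
    fix a :: "real ^ 'm" and v :: "real ^ 'n"
    assume nz: "a \<noteq> 0 \<or> v \<noteq> 0"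
    have young: "2 * (B * norm a * norm v) \<le> \<epsilon> / 2 * (norm a)\<^sup>2 + 2 * B\<^sup>2 / \<epsilon> * (norm v)\<^sup>2"
    proof -
      have "0 \<le> (\<epsilon> * norm a - 2 * B * norm v)\<^sup>2 / (2 * \<epsilon>)"
        using \<epsilon>(1) by simp
      also have "\<dots> = \<epsilon> / 2 * (norm a)\<^sup>2 + 2 * B\<^sup>2 / \<epsilon> * (norm v)\<^sup>2 - 2 * (B * norm a * norm v)"
        using \<epsilon>(1) by (simp add: field_simps power2_eq_square)
      finally show ?thesis by simp
    qed
    have "0 < \<epsilon> / 2 * (norm a)\<^sup>2 + (norm v)\<^sup>2"
      using nz \<epsilon>(1) by (cases "a = 0") (auto intro: add_pos_nonneg)
    moreover have "wnorm_sq X (K *v a + H *v v) \<le> - \<epsilon> * (norm a)\<^sup>2 + 2 * (B * norm a * norm v) + C * (norm v)\<^sup>2"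
      using \<epsilon>(2) [of a] B [of a v] C [of v] by (simp add: wnorm_sq_add [OF sym])
    ultimately show "wnorm_sq X (K *v a + H *v v) < (C + 2 * B\<^sup>2 / \<epsilon> + 1) * (norm v)\<^sup>2"
      using young by (simp add: algebra_simps)
  qed
qed

section \<open>The matrix inequalities as dissipation inequalities\<close>

text \<open>Splitting an arbitrary vector into its four blocks turns the matrix inequality into a
  strict dissipation inequality with storage function \<open>wnorm_sq P\<close>; the two sums on the
  left are the next augmented state and the filter output.\<close>

lemma disturbance_LMI_iff:
  fixes G :: "('x::finite, 'w::finite, 'd::finite, 'y::finite) plant"
    and F :: "('s::finite, 'y, 'w, 'p::finite) filter_ss"
  assumes "transpose P = P" "transpose M = M" "transpose \<Xi> = \<Xi>" "transpose \<Gamma> = \<Gamma>"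
  shows "disturbance_LMI G F M \<rho> P \<Xi> \<Gamma> \<gamma> \<longleftrightarrow> (\<forall>x w d r. x \<noteq> 0 \<or> w \<noteq> 0 \<or> d \<noteq> 0 \<or> r \<noteq> 0 \<longrightarrow>
    wnorm_sq P (aug_A G F *v x + aug_B G F *v w + aug_Bd G F *v vcat d r)
      + wnorm_sq M (aug_C G F *v x + aug_D G F *v w + aug_Dd G F *v vcat d r)
      < \<rho>\<^sup>2 * wnorm_sq P x + \<gamma> * wnorm_sq \<Xi> d + wnorm_sq \<Gamma> r)"
proof -
  have "disturbance_LMI G F M \<rho> P \<Xi> \<Gamma> \<gamma> \<longleftrightarrow> (\<forall>v. v \<noteq> 0 \<longrightarrow>
      wnorm_sq (block_diag (- (\<rho>\<^sup>2 *\<^sub>R P)) (block_diag P (block_diag M (- block_diag (\<gamma> *\<^sub>R \<Xi>) \<Gamma>))))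
        (vcat (hcat (mat 1) (hcat 0 0))
             (vcat (hcat (aug_A G F) (hcat (aug_B G F) (aug_Bd G F)))
             (vcat (hcat (aug_C G F) (hcat (aug_D G F) (aug_Dd G F)))
                   (hcat 0 (hcat 0 (mat 1))))) *v v) < 0)"
    unfolding disturbance_LMI_def Let_def
    by (rule neg_def_congruence) (simp add: transpose_block_diag transpose_minus transpose_scaleR assms)
  also have "\<dots> \<longleftrightarrow> (\<forall>x w d r. x \<noteq> 0 \<or> w \<noteq> 0 \<or> d \<noteq> 0 \<or> r \<noteq> 0 \<longrightarrow>
    wnorm_sq P (aug_A G F *v x + aug_B G F *v w + aug_Bd G F *v vcat d r)
      + wnorm_sq M (aug_C G F *v x + aug_D G F *v w + aug_Dd G F *v vcat d r)
      < \<rho>\<^sup>2 * wnorm_sq P x + \<gamma> * wnorm_sq \<Xi> d + wnorm_sq \<Gamma> r)"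
    (is "(\<forall>v. ?Q v) \<longleftrightarrow> (\<forall>x w d r. ?R x w d r)")
  proof -
    have eq: "?Q (vcat x (vcat w (vcat d r))) \<longleftrightarrow> ?R x w d r" for x w d r
      by (auto simp: vcat_mult_vec hcat_mult_vcat wnorm_sq_block_diag add.assoc)
    show ?thesis
    proof (intro iffI allI)
      fix x w d r
      assume "\<forall>v. ?Q v"
      then show "?R x w d r"
        by (subst eq [symmetric]) (rule spec)
    next
      fix v :: "real ^ (('x + 's) + ('w + ('d + 'y)))"
      assume R: "\<forall>x w d r. ?R x w d r"
      obtain x u where "v = vcat x u" by (rule vcat_surj)
      moreover obtain w q where "u = vcat w q" by (rule vcat_surj)
      moreover obtain d r where "q = vcat d r" by (rule vcat_surj)
      ultimately have v: "v = vcat x (vcat w (vcat d r))" by simp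
      show "?Q v"
        unfolding v by (subst eq) (use R in blast)
    qed
  qed
  finally show ?thesis .
qed

lemma disturbance_LMI_exists:
  fixes G :: "('x::finite, 'w::finite, 'd::finite, 'y::finite) plant"
    and F :: "('s::finite, 'y, 'w, 'p::finite) filter_ss"
  assumes sym: "transpose P = P" "transpose M = M" and \<Xi>: "pos_def \<Xi>" and nom: "nominal_LMI G F M \<rho> P"
  obtains \<Gamma> \<gamma> where "pos_def \<Gamma>" "\<gamma> > 0" "disturbance_LMI G F M \<rho> P \<Xi> \<Gamma> \<gamma>"
proof -
  define X where "X = block_diag (- (\<rho>\<^sup>2 *\<^sub>R P)) (block_diag P M)"
  define K where "K = vcat (hcat (mat 1) 0)
    (vcat (hcat (aug_A G F) (aug_B G F)) (hcat (aug_C G F) (aug_D G F)))"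
  \<comment> \<open>The zero row reflects that disturbances leave the current state alone and enter
    only the next state and the filter output.\<close>
  define H :: "real ^ ('d + 'y) ^ (('x + 's) + (('x + 's) + 'p))"
    where "H = vcat 0 (vcat (aug_Bd G F) (aug_Dd G F))"
  have symX: "transpose X = X"
    by (simp add: X_def transpose_block_diag transpose_minus transpose_scaleR sym)
  have "neg_def (transpose K ** X ** K)"
    using nom by (simp add: nominal_LMI_def Let_def X_def K_def)
  then have "wnorm_sq X (K *v a) < 0" if "a \<noteq> 0" for a
    using that by (simp add: neg_def_congruence [OF symX])
  with symX obtain c where c: "c > 0"
    "\<And>a v. a \<noteq> 0 \<or> v \<noteq> 0 \<Longrightarrow> wnorm_sq X (K *v a + H *v v) < c * (norm v)\<^sup>2"
    using neg_def_perturbation [of X K H] by blast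
  have pos_\<Xi>: "\<And>v. v \<noteq> 0 \<Longrightarrow> 0 < wnorm_sq \<Xi> v" and sym_\<Xi>: "transpose \<Xi> = \<Xi>"
    using \<Xi> by (auto simp: pos_def_def wnorm_sq_def)
  obtain \<mu> where \<mu>: "\<mu> > 0" "\<And>v. \<mu> * (norm v)\<^sup>2 \<le> wnorm_sq \<Xi> v"
    using definite_coercive [OF pos_\<Xi>] by blast
  \<comment> \<open>The perturbation bound is in the Euclidean norm; coercivity of \<Xi> converts it
    to the \<Xi>-norm, which dictates \<open>\<gamma> = c / \<mu>\<close>.\<close>
  have norm_le: "c * (norm v)\<^sup>2 \<le> c / \<mu> * wnorm_sq \<Xi> v" for v
    using \<mu> c(1) mult_left_mono [OF \<mu>(2), of "c / \<mu>" v] by simp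
  show thesis
  proof
    have eq: "v \<bullet> (c *\<^sub>R mat 1 *v v) = c * (norm v)\<^sup>2" for v :: "real ^ 'y"
      by (simp flip: wnorm_sq_def)
    show "pos_def (c *\<^sub>R mat 1 :: real ^ 'y ^ 'y)"
      using c(1) by (simp add: pos_def_def transpose_scaleR eq)
    show "c / \<mu> > 0"
      using c(1) \<mu>(1) by simp
    show "disturbance_LMI G F M \<rho> P \<Xi> (c *\<^sub>R mat 1) (c / \<mu>)"
    proof (subst disturbance_LMI_iff, goal_cases)
      case 5
      show ?case
      proof (intro allI impI)
        fix x :: "real ^ ('x + 's)" and w :: "real ^ 'w" and d :: "real ^ 'd" and r :: "real ^ 'y"
        assume nz: "x \<noteq> 0 \<or> w \<noteq> 0 \<or> d \<noteq> 0 \<or> r \<noteq> 0"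
        have "(norm (vcat d r))\<^sup>2 = (norm d)\<^sup>2 + (norm r)\<^sup>2"
          by (simp add: power2_norm_eq_inner inner_vcat)
        then have "wnorm_sq X (K *v vcat x w + H *v vcat d r) < c * (norm d)\<^sup>2 + c * (norm r)\<^sup>2"
          using c(2) [of "vcat x w" "vcat d r"] nz by (simp add: distrib_left)
        moreover have "K *v vcat x w + H *v vcat d r = vcat x
            (vcat (aug_A G F *v x + aug_B G F *v w + aug_Bd G F *v vcat d r)
                  (aug_C G F *v x + aug_D G F *v w + aug_Dd G F *v vcat d r))"
          by (simp add: K_def H_def vcat_mult_vec hcat_mult_vcat vcat_add)
        ultimately show "wnorm_sq P (aug_A G F *v x + aug_B G F *v w + aug_Bd G F *v vcat d r)
            + wnorm_sq M (aug_C G F *v x + aug_D G F *v w + aug_Dd G F *v vcat d r)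
            < \<rho>\<^sup>2 * wnorm_sq P x + c / \<mu> * wnorm_sq \<Xi> d + wnorm_sq (c *\<^sub>R mat 1) r"
          using norm_le [of d] by (simp add: X_def wnorm_sq_block_diag)
      qed
    qed (simp_all add: sym sym_\<Xi> transpose_scaleR)
  qed
qed

section \<open>Signals along predictions\<close>

text \<open>The state at \<open>T\<close> has seen only inputs before \<open>T\<close>, whereas the
  output also feeds the input at \<open>T\<close> through; hence the strict bound here and the
  non-strict one for outputs.\<close>

lemma filter_state_cong:
  assumes "\<And>j. j < T \<Longrightarrow> y j = y' j" "\<And>j. j < T \<Longrightarrow> w j = w' j"
  shows "filter_state F y w T = filter_state F y' w' T"
  using assms by (induction T) auto

lemma filter_output_cong:
  assumes "\<And>j. j \<le> T \<Longrightarrow> y j = y' j" "\<And>j. j \<le> T \<Longrightarrow> w j = w' j"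
  shows "filter_output F y w T = filter_output F y' w' T"
  using assms filter_state_cong [of T y y' w w' F] by (simp add: filter_output_def)

text \<open>The boundary case \<open>j = t\<close> is included: \<open>y t 0\<close> is the first
  predicted value at time \<open>t\<close> and the last realized one at time
  \<open>Suc t\<close>.\<close>

lemma realized_then_predicted_Suc:
  "j \<le> t \<Longrightarrow> realized_then_predicted y (Suc t) j = realized_then_predicted y t j"
  by (auto simp: realized_then_predicted_def)

lemma realized_then_predicted_add [simp]: "realized_then_predicted y t (t + k) = y t k"
  by (simp add: realized_then_predicted_def)

lemma operator_realized_then_predicted_Suc:
  assumes "causal \<Delta>" "j \<le> t"
  shows "\<Delta> (realized_then_predicted y (Suc t)) j = \<Delta> (realized_then_predicted y t) j"
  using assms realized_then_predicted_Suc unfolding causal_def by blast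

text \<open>The IQC concerns a filter run started at zero, while predictions are continued from
  \<psi>. This identifies the two: along each prediction the recursions coincide, and passing to the
  next prediction changes no input the current state has seen.\<close>

lemma filter_state_predictions:
  assumes "causal \<Delta>" and w: "\<And>t k. w t k = \<Delta> (realized_then_predicted y t) (t + k)"
    and filt: "filter_predictions F y w \<psi> p"
  shows "filter_state F (realized_then_predicted y t) (\<Delta> (realized_then_predicted y t)) (t + k) = \<psi> t k"
proof -
  let ?X = "\<lambda>t. filter_state F (realized_then_predicted y t) (\<Delta> (realized_then_predicted y t))"
  have step: "?X t (t + Suc k) = \<psi> t (Suc k)" if "?X t (t + k) = \<psi> t k" for t k
    using that filt by (simp add: filter_predictions_def w)
  have start: "?X t (t + 0) = \<psi> t 0" for t
  proof (induction t)
    case 0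
    show ?case using filt by (simp add: filter_predictions_def)
  next
    case (Suc t)
    \<comment> \<open>The state at \<open>Suc t\<close> depends on inputs up to \<open>t\<close>
      only, where the two input-output pairs agree by causality.\<close>
    have "?X (Suc t) (Suc t) = ?X t (t + Suc 0)"
      unfolding add_Suc_right add_0_right
      by (rule filter_state_cong)
        (simp_all add: realized_then_predicted_Suc operator_realized_then_predicted_Suc [OF \<open>causal \<Delta>\<close>])
    also have "\<dots> = \<psi> (Suc t) 0"
      using step [OF Suc.IH] filt by (simp add: filter_predictions_def)
    finally show ?case by simp
  qed
  show ?thesis
    by (induction k) (use start step in blast)+
qed

text \<open>Substituting the plant output into the filter eliminates \<open>y\<close>; the offset
  \<open>r\<close> then acts as a second disturbance next to \<open>d\<close>.\<close>

lemma augmented_step: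
  assumes "interconnection G \<Delta> d r e0 e w y" "filter_predictions F y w \<psi> p"
  shows "aug_A G F *v vcat (e t k) (\<psi> t k) + aug_B G F *v w t k + aug_Bd G F *v vcat (d (t + k)) (r t k)
      = vcat (e t (Suc k)) (\<psi> t (Suc k))"
    and "aug_C G F *v vcat (e t k) (\<psi> t k) + aug_D G F *v w t k + aug_Dd G F *v vcat (d (t + k)) (r t k)
      = p t k"
proof -
  have plant: "e t (Suc k) = A_G G *v e t k + Bw_G G *v w t k + Bd_G G *v d (t + k)"
    "y t k = C_G G *v e t k + Dw_G G *v w t k + Dd_G G *v d (t + k) + r t k"
    using assms(1) by (simp_all add: interconnection_def add.commute)
  have filt: "\<psi> t (Suc k) = A_F F *v \<psi> t k + By_F F *v y t k + Bw_F F *v w t k"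
    "p t k = C_F F *v \<psi> t k + Dy_F F *v y t k + Dw_F F *v w t k"
    using assms(2) by (simp_all add: filter_predictions_def)
  note simps = block2_mult_vcat hcat_mult_vcat vcat_mult_vec vcat_add matrix_vector_mult_add_rdistrib
    matrix_vector_right_distrib matrix_vector_mul_assoc [symmetric] add_ac
  show "aug_A G F *v vcat (e t k) (\<psi> t k) + aug_B G F *v w t k + aug_Bd G F *v vcat (d (t + k)) (r t k)
      = vcat (e t (Suc k)) (\<psi> t (Suc k))"
    by (simp add: aug_A_def aug_B_def aug_Bd_def plant filt simps)
  show "aug_C G F *v vcat (e t k) (\<psi> t k) + aug_D G F *v w t k + aug_Dd G F *v vcat (d (t + k)) (r t k)
      = p t k"
    by (simp add: aug_C_def aug_D_def aug_Dd_def plant filt simps)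
qed

section \<open>The upper bound along predictions\<close>

lemma bound_c_dissipation:
  assumes "transpose P = P" "transpose M = M" "transpose \<Xi> = \<Xi>" "transpose \<Gamma> = \<Gamma>"
    and lmi: "disturbance_LMI G F M \<rho> P \<Xi> \<Gamma> \<gamma>"
    and "interconnection G \<Delta> d r e0 e w y" "filter_predictions F y w \<psi> p"
  shows "bound_c P \<rho> \<Xi> \<Gamma> \<gamma> d r e \<psi> t (Suc k) - wnorm_sq P (vcat (e t (Suc k)) (\<psi> t (Suc k)))
    \<ge> \<rho>\<^sup>2 * (bound_c P \<rho> \<Xi> \<Gamma> \<gamma> d r e \<psi> t k - wnorm_sq P (vcat (e t k) (\<psi> t k)))
      + wnorm_sq M (p t k)"
proof -
  let ?x = "vcat (e t k) (\<psi> t k)"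
  have "wnorm_sq P (aug_A G F *v x + aug_B G F *v w + aug_Bd G F *v vcat d r)
      + wnorm_sq M (aug_C G F *v x + aug_D G F *v w + aug_Dd G F *v vcat d r)
      \<le> \<rho>\<^sup>2 * wnorm_sq P x + \<gamma> * wnorm_sq \<Xi> d + wnorm_sq \<Gamma> r" for x w d r
  \<comment> \<open>The strict inequality is available away from the origin only; at the origin both
    sides vanish.\<close>
  proof (cases "x \<noteq> 0 \<or> w \<noteq> 0 \<or> d \<noteq> 0 \<or> r \<noteq> 0")
    case True
    with lmi show ?thesis
      using disturbance_LMI_iff [OF assms(1-4)] by (metis less_imp_le)
  qed simp
  from this [of ?x "w t k" "d (t + k)" "r t k"]
  show ?thesis
    unfolding augmented_step [OF assms(6,7)] by (simp add: algebra_simps)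
qed

lemma bound_c_upper_bound:
  assumes sym: "transpose P = P" "transpose M = M" "transpose \<Xi> = \<Xi>" "transpose \<Gamma> = \<Gamma>"
    and "causal \<Delta>" and "0 < \<rho>" and iqc: "rho_hard_IQC \<rho> F M \<Delta>"
    and lmi: "disturbance_LMI G F M \<rho> P \<Xi> \<Gamma> \<gamma>"
    and inter: "interconnection G \<Delta> d r e0 e w y" and filt: "filter_predictions F y w \<psi> p"
  shows "wnorm_sq P (vcat (e t k) (\<psi> t k)) \<le> bound_c P \<rho> \<Xi> \<Gamma> \<gamma> d r e \<psi> t k"
proof -
  \<comment> \<open>\<open>a\<close> is \<rho>^(-2), so the weights of the IQC are the powers of
    \<open>a\<close>; \<open>S\<close> is the gap to be shown nonnegative.\<close>
  define a where "a = inverse (\<rho>\<^sup>2)"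
  define S where "S t k = bound_c P \<rho> \<Xi> \<Gamma> \<gamma> d r e \<psi> t k - wnorm_sq P (vcat (e t k) (\<psi> t k))" for t k
  define m where "m t j = wnorm_sq M
    (filter_output F (realized_then_predicted y t) (\<Delta> (realized_then_predicted y t)) j)" for t j
  have a: "a > 0" "a * \<rho>\<^sup>2 = 1"
    using \<open>0 < \<rho>\<close> by (simp_all add: a_def)
  have w: "w t k = \<Delta> (realized_then_predicted y t) (t + k)" for t k
    using inter by (simp add: interconnection_def)
  have m_pred: "m t (t + k) = wnorm_sq M (p t k)" for t k
    using filt by (simp add: m_def filter_output_def filter_predictions_def
        filter_state_predictions [OF \<open>causal \<Delta>\<close> w filt] w)
  \<comment> \<open>Consecutive input-output pairs of \<Delta> share their values up to time
    \<open>t\<close>, hence also the supply terms.\<close>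
  have m_Suc: "m (Suc t) j = m t j" if "j \<le> t" for t j
    unfolding m_def using that
    by (intro arg_cong [where f = "wnorm_sq M"] filter_output_cong)
      (simp_all add: realized_then_predicted_Suc operator_realized_then_predicted_Suc [OF \<open>causal \<Delta>\<close>])
  have m_sum: "(\<Sum>j<T. a ^ j * m t j) \<ge> 0" for t T
  \<comment> \<open>The IQC covers \<open>T \<ge> 1\<close>; for \<open>T = 0\<close> the sum is
    empty.\<close>
  proof (cases "T = 0")
    case False
    have "\<rho> powi (- 2 * int j) = a ^ j" for j
      by (simp add: a_def power_int_minus power_int_mult power_inverse flip: power_mult)
    with iqc False show ?thesis
      by (simp add: rho_hard_IQC_def m_def wnorm_sq_def)
  qed simp
  \<comment> \<open>The dissipation inequality scaled by \<open>a ^ (t + Suc k)\<close> adds exactly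
    one summand of the IQC. The outer factor \<open>a\<close> compensates for the IQC weighting that
    summand by \<open>a ^ (t + k)\<close> only.\<close>
  have step: "a * (\<Sum>j<t + Suc k. a ^ j * m t j) \<le> a ^ (t + Suc k) * S t (Suc k)"
    if IH: "a * (\<Sum>j<t + k. a ^ j * m t j) \<le> a ^ (t + k) * S t k" for t k
  proof -
    have "a * (\<Sum>j<t + Suc k. a ^ j * m t j) \<le> a ^ (t + k) * S t k + a ^ (t + Suc k) * m t (t + k)"
      using IH by (simp add: distrib_left)
    also have "\<dots> = a ^ (t + Suc k) * (\<rho>\<^sup>2 * S t k + m t (t + k))"
      using a(2) by (simp add: algebra_simps)
    also have "\<dots> \<le> a ^ (t + Suc k) * S t (Suc k)"
      using bound_c_dissipation [OF sym lmi inter filt, of t k] a(1)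
      by (intro mult_left_mono) (simp_all add: S_def m_pred del: bound_c.simps)
    finally show ?thesis .
  qed
  \<comment> \<open>Initially the sum is empty and \<open>S 0 0 = 0\<close>. At a change of
    prediction neither side changes: the partial sum ends at \<open>t\<close>, and the correction in
    \<open>bound_c\<close> cancels the jump of the storage function.\<close>
  have start: "a * (\<Sum>j<t + 0. a ^ j * m t j) \<le> a ^ (t + 0) * S t 0" for t
  proof (induction t)
    case 0
    show ?case using filt by (simp add: S_def filter_predictions_def)
  next
    case (Suc t)
    have "(\<Sum>j<Suc t. a ^ j * m (Suc t) j) = (\<Sum>j<t + Suc 0. a ^ j * m t j)"
      by (rule sum.cong) (simp_all add: m_Suc)
    moreover have "S (Suc t) 0 = S t (Suc 0)"
      by (simp add: S_def)
    ultimately show ?case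
      using step [OF Suc.IH] by simp
  qed
  have "a * (\<Sum>j<t + k. a ^ j * m t j) \<le> a ^ (t + k) * S t k"
    by (induction k) (use start step in blast)+
  moreover have "0 \<le> a * (\<Sum>j<t + k. a ^ j * m t j)"
    using a(1) m_sum by simp
  ultimately have "S t k \<ge> 0"
    using a(1) by (metis order_trans zero_le_mult_iff zero_less_power not_less)
  then show ?thesis
    by (simp add: S_def)
qed

theorem lemma1:
  fixes G :: "('x::finite, 'w::finite, 'd::finite, 'y::finite) plant"
    and \<Delta> :: "'y signal \<Rightarrow> 'w signal"
    and \<Psi> :: "('s::finite, 'y, 'w, 'p::finite) filter_ss"
    and M :: "real ^ 'p ^ 'p"
    and \<rho> :: real
    and P :: "real ^ ('x + 's) ^ ('x + 's)"
    and \<Xi> :: "real ^ 'd ^ 'd"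
  assumes "causal \<Delta>" and "bounded_operator \<Delta>" and "well_posed G \<Delta>"
    and "stable_filter \<Psi>"
    and "transpose M = M"
    and "0 < \<rho>" and "\<rho> \<le> 1"
    and "rho_hard_IQC \<rho> \<Psi> M \<Delta>"
    and "pos_def P" and "nominal_LMI G \<Psi> M \<rho> P"
    and "pos_def \<Xi>"
  shows "(\<exists>(\<Gamma> :: real ^ 'y ^ 'y) \<gamma>.
            pos_def \<Gamma> \<and> \<gamma> > 0 \<and> disturbance_LMI G \<Psi> M \<rho> P \<Xi> \<Gamma> \<gamma>) \<and>
         (\<forall>(\<Gamma> :: real ^ 'y ^ 'y) \<gamma>.
            pos_def \<Gamma> \<and> \<gamma> > 0 \<and> disturbance_LMI G \<Psi> M \<rho> P \<Xi> \<Gamma> \<gamma> \<longrightarrow>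
            (\<forall>d r e0 e w y \<psi> p.
               interconnection G \<Delta> d r e0 e w y \<and> filter_predictions \<Psi> y w \<psi> p \<longrightarrow>
               (\<forall>t k. wnorm_sq P (vcat (e t k) (\<psi> t k))
                        \<le> bound_c P \<rho> \<Xi> \<Gamma> \<gamma> d r e \<psi> t k)))"
proof (intro conjI allI impI)
  have sym: "transpose P = P" "transpose \<Xi> = \<Xi>"
    using \<open>pos_def P\<close> \<open>pos_def \<Xi>\<close> by (simp_all add: pos_def_def)
  show "\<exists>(\<Gamma> :: real ^ 'y ^ 'y) \<gamma>. pos_def \<Gamma> \<and> \<gamma> > 0 \<and> disturbance_LMI G \<Psi> M \<rho> P \<Xi> \<Gamma> \<gamma>"
    using disturbance_LMI_exists [OF sym(1) \<open>transpose M = M\<close> \<open>pos_def \<Xi>\<close> \<open>nominal_LMI G \<Psi> M \<rho> P\<close>]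
    by metis
  fix \<Gamma> :: "real ^ 'y ^ 'y" and \<gamma> d r e0 e w y \<psi> p t k
  assume "pos_def \<Gamma> \<and> \<gamma> > 0 \<and> disturbance_LMI G \<Psi> M \<rho> P \<Xi> \<Gamma> \<gamma>"
    and "interconnection G \<Delta> d r e0 e w y \<and> filter_predictions \<Psi> y w \<psi> p"
  then show "wnorm_sq P (vcat (e t k) (\<psi> t k)) \<le> bound_c P \<rho> \<Xi> \<Gamma> \<gamma> d r e \<psi> t k"
    using bound_c_upper_bound [OF sym(1) \<open>transpose M = M\<close> sym(2) _ \<open>causal \<Delta>\<close> \<open>0 < \<rho>\<close>
        \<open>rho_hard_IQC \<rho> \<Psi> M \<Delta>\<close>]
    unfolding pos_def_def by blast
qed

end
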